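(* Let $q$ be an odd prime power and $\mathcal{P}$ a set of $8q^2$ points in $\mathbb{F}_q^3$. Then the number of distinct spheres determined by $\mathcal{P}$ is at least $q^4/9$.
   Context: A sphere in $\mathbb{F}_q^3$ with center $(e_1,e_2,e_3)\in\mathbb{F}_q^3$ and radius $r\in\mathbb{F}_q$ is the set $\{(x,y,z)\in\mathbb{F}_q^3:(x-e_1)^2+(y-e_2)^2+(z-e_3)^2=r\}$. A sphere is determined by $\mathcal{P}$ if it passes through four non-coplanar points of $\mathcal{P}$. *)

theory Defs
  imports "HOL-Analysis.Cartesian_Space" "HOL-Number_Theory.Prime_Powers"
begin

text \<open>
  The library's \<open>sphere\<close> and \<open>coplanar\<close> are tied to metric and real vector spaces;
  these are their counterparts in the affine space \<open>K\<^sup>3\<close> over an arbitrary field \<open>K\<close>.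
  The radius \<open>r\<close> enters unsquared and may be zero or a non-square.
\<close>

definition field_sphere :: "'a::field ^ 3 \<Rightarrow> 'a \<Rightarrow> ('a ^ 3) set" where
  "field_sphere e r =
     {v. (v $ 1 - e $ 1)\<^sup>2 + (v $ 2 - e $ 2)\<^sup>2 + (v $ 3 - e $ 3)\<^sup>2 = r}"

definition field_plane :: "'a::field ^ 3 \<Rightarrow> 'a \<Rightarrow> ('a ^ 3) set" where
  "field_plane n d = {v. n $ 1 * v $ 1 + n $ 2 * v $ 2 + n $ 3 * v $ 3 = d}"

definition field_coplanar :: "('a::field ^ 3) set \<Rightarrow> bool" where
  "field_coplanar A \<longleftrightarrow> (\<exists>n d. n \<noteq> 0 \<and> A \<subseteq> field_plane n d)"

text \<open>
  Spheres are counted as point sets. Distinctness of the four points is automatic, since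
  any three points lie in a common plane.
\<close>

definition determined_spheres :: "('a::field ^ 3) set \<Rightarrow> ('a ^ 3) set set" where
  "determined_spheres P =
     {S. (\<exists>e r. S = field_sphere e r) \<and>
         (\<exists>a b c d. {a, b, c, d} \<subseteq> P \<inter> S \<and> \<not> field_coplanar {a, b, c, d})}"

end

theory Submission
  imports Defs "HOL-Computational_Algebra.Polynomial" "HOL-Number_Theory.Residues"
begin

text \<open>
  Index spheres by pairs (centre, radius). A point lies on \<open>q\<^sup>3\<close> of these \<open>q\<^sup>4\<close> spheres and
  two distinct points lie on at most \<open>q\<^sup>2\<close> common ones, because the centre is confined to the
  bisector plane. Hence the number of points of \<open>P\<close> on a sphere has mean \<open>8q\<close>, and its squared
  deviations sum to at most \<open>8q\<^sup>5\<close>. A plane section of a sphere is a conic and has at most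
  \<open>2q\<close> points, so a sphere that meets \<open>P\<close> in a coplanar set deviates from the mean by at least
  \<open>6q\<close>; by Chebyshev there are at most \<open>2q\<^sup>3/9\<close> of those. All other spheres are determined.
\<close>

section \<open>Odd characteristic and point counts of conics\<close>

text \<open>The characteristic divides the cardinality of the field, so it cannot be 2.\<close>

lemma two_neq_zero_if_odd_card:
  assumes "odd CARD('a::{field,finite})"
  shows "(2::'a) \<noteq> 0"
proof
  assume "(2::'a) = 0"
  then have "of_nat 2 = (0::'a)" by simp
  then have "CHAR('a) dvd 2" by (simp only: of_nat_eq_0_iff_char_dvd)
  moreover have "CHAR('a) \<noteq> 1"
    using CHAR_not_1' by simp
  ultimately have "CHAR('a) = 2"
    using prime_nat_iff two_is_prime_nat by blast
  then show False
    using CHAR_dvd_CARD[where 'a='a] assms by simp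
qed

lemma card_quadratic_roots_le:
  fixes a b c :: "'a::{field,finite}"
  assumes "a \<noteq> 0"
  shows "card {x. a * x\<^sup>2 + b * x + c = 0} \<le> 2"
proof -
  have "card {x. poly [:c, b, a:] x = 0} \<le> degree [:c, b, a:]"
    using assms by (intro card_poly_roots_bound) auto
  moreover have "{x. poly [:c, b, a:] x = 0} = {x. a * x\<^sup>2 + b * x + c = 0}"
    by (simp add: algebra_simps power2_eq_square)
  ultimately show ?thesis using assms by simp
qed

lemma card_eq_sum_card_fst:
  fixes S :: "('a::finite \<times> 'b::finite) set"
  shows "card S = (\<Sum>x\<in>UNIV. card {y. (x, y) \<in> S})"
proof -
  have "card S = card (Sigma UNIV (\<lambda>x. {y. (x, y) \<in> S}))"
    by (rule arg_cong[where f = card]) auto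
  then show ?thesis by simp
qed

text \<open>For fixed \<open>x\<close> the equation is quadratic in \<open>y\<close> with leading
  coefficient \<open>c\<close>, so each of the q fibres has at most two points.\<close>

lemma card_conic_le_aux:
  fixes a b c d e f :: "'a::{field,finite}"
  assumes "c \<noteq> 0"
  shows "card {(x, y). a * x\<^sup>2 + b * x * y + c * y\<^sup>2 + d * x + e * y + f = 0} \<le> 2 * CARD('a)"
proof -
  have *: "card {y. a * x\<^sup>2 + b * x * y + c * y\<^sup>2 + d * x + e * y + f = 0} \<le> 2" for x
    using card_quadratic_roots_le[OF assms, of "b * x + e" "a * x\<^sup>2 + d * x + f"]
    by (simp add: algebra_simps)
  show ?thesis
    by (subst card_eq_sum_card_fst, rule order.trans[OF sum_mono[where g = "\<lambda>_. 2"]])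
      (use * in auto)
qed

text \<open>A nonzero square coefficient reduces to the fibre count above, after swapping the
  coordinates if necessary. If only the mixed term survives, the fibres are described by a linear
  equation.\<close>

lemma card_conic_le:
  fixes a b c d e f :: "'a::{field,finite}"
  assumes "a \<noteq> 0 \<or> b \<noteq> 0 \<or> c \<noteq> 0"
  shows "card {(x, y). a * x\<^sup>2 + b * x * y + c * y\<^sup>2 + d * x + e * y + f = 0} \<le> 2 * CARD('a)"
    (is "card ?S \<le> _")
proof -
  consider "c \<noteq> 0" | "a \<noteq> 0" | "a = 0" "c = 0" "b \<noteq> 0" using assms by blast
  then show ?thesis
  proof cases
    case 1
    then show ?thesis by (rule card_conic_le_aux)
  next
    case 2
    have "card ?S = card (prod.swap ` ?S)"
      by (simp add: card_image)
    also have "prod.swap ` ?S =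
        {(y, x). c * y\<^sup>2 + b * y * x + a * x\<^sup>2 + e * y + d * x + f = 0}"
      by (auto simp: image_iff algebra_simps)
    finally show ?thesis
      using card_conic_le_aux[OF 2, of c b e d f] by simp
  next
    case 3
    \<comment> \<open>The curve reads \<open>(b * x + e) * y = - (d * x + f)\<close>: at most one
      \<open>y\<close> for each \<open>x\<close>, except over \<open>x = - e / b\<close>, where a
      whole line may lie on it. The spare 1 in that fibre makes the bounds sum to exactly q +
      q.\<close>
    have le: "card {y. (x, y) \<in> ?S} \<le> 1 + (if x = - e / b then CARD('a) else 0)" for x
    proof (cases "x = - e / b")
      case True
      then show ?thesis by (simp add: card_mono le_SucI)
    next
      case False
      then have "b * x + e \<noteq> 0"
        using 3 by (auto simp: field_simps add_eq_0_iff)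
      moreover have "(b * x + e) * y = - (d * x + f)" if "(x, y) \<in> ?S" for y
        using that 3 by (simp add: algebra_simps eq_neg_iff_add_eq_0)
      ultimately have "{y. (x, y) \<in> ?S} \<subseteq> {- (d * x + f) / (b * x + e)}"
        by (auto simp: nonzero_eq_divide_eq mult.commute)
      from card_mono[OF _ this] show ?thesis using False by simp
    qed
    show ?thesis
      by (subst card_eq_sum_card_fst, rule order.trans[OF sum_mono[OF le]])
        (simp only: sum.distrib, simp)
  qed
qed

section \<open>Plane sections of spheres and the size of planes\<close>

lemma card_graph_section_le:
  fixes a b c r :: "'a::{field,finite}"
  assumes "(2::'a) \<noteq> 0"
  shows "card {(x, y). x\<^sup>2 + y\<^sup>2 + (a * x + b * y + c)\<^sup>2 = r} \<le> 2 * CARD('a)"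
proof -
  \<comment> \<open>As 2 is invertible, a vanishing mixed coefficient forces \<open>a = 0\<close> or
    \<open>b = 0\<close>, and then one of the square coefficients is 1.\<close>
  have nz: "1 + a\<^sup>2 \<noteq> 0 \<or> 2 * a * b \<noteq> 0 \<or> 1 + b\<^sup>2 \<noteq> 0"
    using assms by auto
  have "{(x, y). x\<^sup>2 + y\<^sup>2 + (a * x + b * y + c)\<^sup>2 = r} =
    {(x, y). (1 + a\<^sup>2) * x\<^sup>2 + (2 * a * b) * x * y + (1 + b\<^sup>2) * y\<^sup>2
      + (2 * a * c) * x + (2 * b * c) * y + (c\<^sup>2 - r) = 0}"
    by (auto simp: algebra_simps power2_eq_square)
  then show ?thesis using card_conic_le[OF nz, of "2 * a * c" "2 * b * c" "c\<^sup>2 - r"] by simp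
qed

text \<open>Solving the plane equation for a coordinate with nonzero coefficient and projecting to
  the other two maps the section injectively into a conic.\<close>

lemma card_plane_section_le:
  fixes n e :: "'a::{field,finite} ^ 3"
  assumes "(2::'a) \<noteq> 0" and "n \<noteq> 0"
  shows "card (field_sphere e r \<inter> field_plane n d) \<le> 2 * CARD('a)"
proof -
  let ?S = "field_sphere e r \<inter> field_plane n d"
  \<comment> \<open>An arbitrary labelling \<open>i\<close>, \<open>j\<close>, \<open>k\<close> of
    the coordinates lets the three choices of the eliminated coordinate \<open>k\<close> share one
    argument.\<close>
  have section_le: "card ?S \<le> 2 * CARD('a)"
    if ijk: "\<And>l::3. l = i \<or> l = j \<or> l = k" and n: "n $ k \<noteq> 0"
      and sphere: "\<And>v. v \<in> ?S \<Longrightarrow> (v $ i - e $ i)\<^sup>2 + (v $ j - e $ j)\<^sup>2 + (v $ k - e $ k)\<^sup>2 = r"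
      and plane: "\<And>v. v \<in> ?S \<Longrightarrow> n $ i * v $ i + n $ j * v $ j + n $ k * v $ k = d"
    for i j k
  proof -
    let ?f = "\<lambda>v::'a ^ 3. (v $ i - e $ i, v $ j - e $ j)"
    let ?a = "- n $ i / n $ k" and ?b = "- n $ j / n $ k"
      and ?c = "(d - n $ i * e $ i - n $ j * e $ j - n $ k * e $ k) / n $ k"
    have third: "v $ k - e $ k = ?a * (v $ i - e $ i) + ?b * (v $ j - e $ j) + ?c"
      if "v \<in> ?S" for v
      unfolding plane[OF that, symmetric] using n by (simp add: field_simps)
    have "inj_on ?f ?S"
    proof (rule inj_onI)
      fix v w assume v: "v \<in> ?S" and w: "w \<in> ?S" and eq: "?f v = ?f w"
      have "v $ k - e $ k = w $ k - e $ k"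
        using third[OF v] third[OF w] eq by simp
      then have "v $ i = w $ i \<and> v $ j = w $ j \<and> v $ k = w $ k" using eq by simp
      then have "v $ l = w $ l" for l using ijk[of l] by auto
      then show "v = w" by (simp add: vec_eq_iff)
    qed
    then have "card ?S = card (?f ` ?S)" by (simp add: card_image)
    also have "\<dots> \<le> card {(x, y). x\<^sup>2 + y\<^sup>2 + (?a * x + ?b * y + ?c)\<^sup>2 = r}"
      using sphere third by (intro card_mono) auto
    also have "\<dots> \<le> 2 * CARD('a)"
      by (rule card_graph_section_le[OF assms(1)])
    finally show ?thesis .
  qed
  from assms(2) consider "n $ 3 \<noteq> 0" | "n $ 2 \<noteq> 0" | "n $ 1 \<noteq> 0"
    by (auto simp: vec_eq_iff forall_3)
  then show ?thesis
  proof cases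
    case 1
    show ?thesis
      by (rule section_le[of 1 2 3], metis exhaust_3)
        (use 1 in \<open>auto simp: field_sphere_def field_plane_def\<close>)
  next
    case 2
    show ?thesis
      by (rule section_le[of 1 3 2], metis exhaust_3)
        (use 2 in \<open>auto simp: field_sphere_def field_plane_def algebra_simps\<close>)
  next
    case 3
    show ?thesis
      by (rule section_le[of 2 3 1], metis exhaust_3)
        (use 3 in \<open>auto simp: field_sphere_def field_plane_def algebra_simps\<close>)
  qed
qed

text \<open>Forgetting a coordinate whose coefficient in \<open>n\<close> is nonzero is injective on
  the plane.\<close>

lemma card_field_plane_le:
  fixes n :: "'a::{field,finite} ^ 3"
  assumes "n \<noteq> 0"
  shows "card (field_plane n d) \<le> CARD('a)\<^sup>2"
proof -
  have plane_le: "card (field_plane n d) \<le> CARD('a)\<^sup>2"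
    if ijk: "\<And>l::3. l = i \<or> l = j \<or> l = k" and n: "n $ k \<noteq> 0"
      and plane: "\<And>v. v \<in> field_plane n d \<Longrightarrow> n $ i * v $ i + n $ j * v $ j + n $ k * v $ k = d"
    for i j k
  proof -
    let ?f = "\<lambda>v::'a ^ 3. (v $ i, v $ j)"
    have "inj_on ?f (field_plane n d)"
    proof (rule inj_onI)
      fix v w assume v: "v \<in> field_plane n d" and w: "w \<in> field_plane n d" and eq: "?f v = ?f w"
      have "n $ k * v $ k = n $ k * w $ k"
        using plane[OF v] plane[OF w] eq by (metis add_left_cancel prod.inject)
      then have "v $ i = w $ i \<and> v $ j = w $ j \<and> v $ k = w $ k" using n eq by simp
      then have "v $ l = w $ l" for l using ijk[of l] by auto
      then show "v = w" by (simp add: vec_eq_iff)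
    qed
    then have "card (field_plane n d) \<le> CARD('a \<times> 'a)"
      by (intro card_inj_on_le) auto
    then show ?thesis by (simp add: power2_eq_square)
  qed
  from assms consider "n $ 3 \<noteq> 0" | "n $ 2 \<noteq> 0" | "n $ 1 \<noteq> 0"
    by (auto simp: vec_eq_iff forall_3)
  then show ?thesis
  proof cases
    case 1
    show ?thesis
      by (rule plane_le[of 1 2 3], metis exhaust_3)
        (use 1 in \<open>auto simp: field_plane_def\<close>)
  next
    case 2
    show ?thesis
      by (rule plane_le[of 1 3 2], metis exhaust_3)
        (use 2 in \<open>auto simp: field_plane_def algebra_simps\<close>)
  next
    case 3
    show ?thesis
      by (rule plane_le[of 2 3 1], metis exhaust_3)
        (use 3 in \<open>auto simp: field_plane_def algebra_simps\<close>)
  qed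
qed

section \<open>Coplanarity and the triple product\<close>

text \<open>The usual cross product; \<open>dot3 (cross_field u w) t\<close> is the determinant of
  \<open>u\<close>, \<open>w\<close>, \<open>t\<close> and serves as the test for coplanarity of
  four points.\<close>

definition cross_field :: "'a::field ^ 3 \<Rightarrow> 'a ^ 3 \<Rightarrow> 'a ^ 3" where
  "cross_field u w = vector [u $ 2 * w $ 3 - u $ 3 * w $ 2,
     u $ 3 * w $ 1 - u $ 1 * w $ 3, u $ 1 * w $ 2 - u $ 2 * w $ 1]"

definition dot3 :: "'a::field ^ 3 \<Rightarrow> 'a ^ 3 \<Rightarrow> 'a" where
  "dot3 u w = u $ 1 * w $ 1 + u $ 2 * w $ 2 + u $ 3 * w $ 3"

lemma cross_field_nth [simp]:
  "cross_field u w $ 1 = u $ 2 * w $ 3 - u $ 3 * w $ 2"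
  "cross_field u w $ 2 = u $ 3 * w $ 1 - u $ 1 * w $ 3"
  "cross_field u w $ 3 = u $ 1 * w $ 2 - u $ 2 * w $ 1"
  by (simp_all add: cross_field_def)

text \<open>The plane is the one through \<open>a\<close> with normal \<open>n\<close>. The base
  point \<open>a\<close> may lie in \<open>A\<close> or not, so the empty set is covered in the same
  way.\<close>

lemma field_coplanarI:
  assumes "n \<noteq> 0" and "\<And>x. x \<in> A \<Longrightarrow> dot3 n (x - a) = 0"
  shows "field_coplanar A"
  unfolding field_coplanar_def
proof (intro exI conjI)
  show "A \<subseteq> field_plane n (dot3 n a)"
    using assms(2) by (auto simp: field_plane_def dot3_def algebra_simps)
qed (fact assms(1))

text \<open>Componentwise form of the identity det(u,w,t) n = (n.u)(w x t) + (n.w)(t x u) + (n.t)(u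
  x w), whose right-hand side vanishes.\<close>

lemma triple_product_mult_eq_0:
  fixes n u w t :: "'a::field ^ 3"
  assumes "dot3 n u = 0" and "dot3 n w = 0" and "dot3 n t = 0"
  shows "dot3 (cross_field u w) t * n $ i = 0"
proof -
  have "dot3 (cross_field u w) t * n $ 1 = dot3 n u * cross_field w t $ 1
      + dot3 n w * cross_field t u $ 1 + dot3 n t * cross_field u w $ 1"
    "dot3 (cross_field u w) t * n $ 2 = dot3 n u * cross_field w t $ 2
      + dot3 n w * cross_field t u $ 2 + dot3 n t * cross_field u w $ 2"
    "dot3 (cross_field u w) t * n $ 3 = dot3 n u * cross_field w t $ 3
      + dot3 n w * cross_field t u $ 3 + dot3 n t * cross_field u w $ 3"
    by (simp_all add: dot3_def algebra_simps)
  then show ?thesis using assms exhaust_3[of i] by auto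
qed

lemma not_field_coplanar_if_triple_product:
  assumes "dot3 (cross_field (b - a) (c - a)) (d - a) \<noteq> 0"
  shows "\<not> field_coplanar {a, b, c, d}"
proof
  assume "field_coplanar {a, b, c, d}"
  then obtain n k where n: "n \<noteq> 0" and sub: "{a, b, c, d} \<subseteq> field_plane n k"
    by (auto simp: field_coplanar_def)
  have "dot3 n (x - a) = 0" if "x \<in> {a, b, c, d}" for x
  proof -
    have "x \<in> field_plane n k" "a \<in> field_plane n k" using that sub by auto
    then show ?thesis by (simp add: field_plane_def dot3_def algebra_simps)
  qed
  then have "dot3 (cross_field (b - a) (c - a)) (d - a) * n $ i = 0" for i
    by (intro triple_product_mult_eq_0) auto
  then have "n = 0" using assms by (simp add: vec_eq_iff)
  with n show False by simp
qed

text \<open>A non-coplanar set is not contained in a line, so it has three points with nonzero cross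
  product; the plane through them cannot contain the whole set, which yields the fourth
  point.\<close>

lemma not_field_coplanar_imp_four_points:
  fixes A :: "('a::field ^ 3) set"
  assumes "\<not> field_coplanar A"
  obtains a b c d where "{a, b, c, d} \<subseteq> A" "\<not> field_coplanar {a, b, c, d}"
proof -
  have "\<exists>a\<in>A. \<exists>b\<in>A. \<exists>c\<in>A. cross_field (b - a) (c - a) \<noteq> 0"
  proof (rule ccontr)
    assume "\<not> ?thesis"
    then have cross: "cross_field (b - a) (c - a) = 0" if "a \<in> A" "b \<in> A" "c \<in> A" for a b c
      using that by blast
    have ex1: "axis 1 1 \<noteq> (0::'a ^ 3)" by (simp add: axis_eq_0_iff)
    have "\<exists>a b. a \<in> A \<and> b \<in> A \<and> a \<noteq> b"
    proof (rule ccontr)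
      assume "\<not> ?thesis"
      then obtain a where "A \<subseteq> {a}" by blast
      then have "field_coplanar A"
        by (intro field_coplanarI[OF ex1, of _ a]) (auto simp: dot3_def)
      with assms show False by simp
    qed
    then obtain a b where ab: "a \<in> A" "b \<in> A" "a \<noteq> b" by blast
    define u where "u = b - a"
    have "u \<noteq> 0" using ab by (simp add: u_def)
    have c0: "cross_field u (x - a) $ i = 0" if "x \<in> A" for x i
      using cross[OF ab(1,2) that] by (simp add: u_def)
    \<comment> \<open>Now \<open>A\<close> lies on the line through \<open>a\<close> with direction
      \<open>u\<close>, and a plane containing that line is needed. If \<open>u\<close> is parallel
      to the third axis, fixing the first coordinate gives one.\<close>
    show False
    proof (cases "u $ 1 = 0 \<and> u $ 2 = 0")
      case True
      then have "u $ 3 \<noteq> 0" using \<open>u \<noteq> 0\<close> by (auto simp: vec_eq_iff forall_3)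
      then have "dot3 (axis 1 1) (x - a) = 0" if "x \<in> A" for x
        using c0[OF that, of 2] True by (simp add: dot3_def axis_def)
      then show False using field_coplanarI[OF ex1] assms by blast
    next
      case False
      \<comment> \<open>A nonzero vector orthogonal to \<open>u\<close>, chosen so that
        \<open>dot3 n (x - a)\<close> is the third coordinate of
        \<open>cross_field u (x - a)\<close>.\<close>
      define n :: "'a ^ 3" where "n = vector [- (u $ 2), u $ 1, 0]"
      have "n \<noteq> 0" using False by (auto simp: n_def vec_eq_iff forall_3)
      moreover have "dot3 n (x - a) = 0" if "x \<in> A" for x
        using c0[OF that, of 3] by (simp add: dot3_def n_def algebra_simps)
      ultimately show False using field_coplanarI assms by blast
    qed
  qed
  then obtain a b c where abc: "a \<in> A" "b \<in> A" "c \<in> A" "cross_field (b - a) (c - a) \<noteq> 0"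
    by blast
  then obtain d where "d \<in> A" "dot3 (cross_field (b - a) (c - a)) (d - a) \<noteq> 0"
    using field_coplanarI assms by blast
  with abc show ?thesis
    using that[of a b c d] not_field_coplanar_if_triple_product by blast
qed

section \<open>Intersections of spheres and spheres through given points\<close>

text \<open>Subtracting the two sphere equations cancels the squares of the coordinates of the point
  and leaves the radical plane, a genuine plane whenever its normal is nonzero.\<close>

lemma field_spheres_inter_subset_plane:
  "field_sphere e r \<inter> field_sphere e' r' \<subseteq> field_plane (2 *s (e' - e))
     (r - r' - (dot3 e e - dot3 e' e'))"
proof
  fix v assume "v \<in> field_sphere e r \<inter> field_sphere e' r'"
  then have r: "r = (v $ 1 - e $ 1)\<^sup>2 + (v $ 2 - e $ 2)\<^sup>2 + (v $ 3 - e $ 3)\<^sup>2"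
    and r': "r' = (v $ 1 - e' $ 1)\<^sup>2 + (v $ 2 - e' $ 2)\<^sup>2 + (v $ 3 - e' $ 3)\<^sup>2"
    by (auto simp: field_sphere_def)
  show "v \<in> field_plane (2 *s (e' - e)) (r - r' - (dot3 e e - dot3 e' e'))"
    by (simp add: r r' field_plane_def dot3_def algebra_simps power2_eq_square)
qed

text \<open>Different centres would put the whole sphere into the radical plane; with equal centres
  any common point fixes the radius. This allows passing from pairs (centre, radius) to spheres as
  point sets.\<close>

lemma field_sphere_eq_imp:
  fixes e e' :: "'a::field ^ 3"
  assumes "(2::'a) \<noteq> 0" and "field_sphere e r = field_sphere e' r'"
    and "\<not> field_coplanar (field_sphere e r)"
  shows "e = e' \<and> r = r'"
proof -
  have "e = e'"
  proof (rule ccontr)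
    assume "e \<noteq> e'"
    then have "2 *s (e' - e) \<noteq> 0" using assms(1) by (simp add: vector_mul_eq_0)
    then have "field_coplanar (field_sphere e r)"
      using field_spheres_inter_subset_plane[of e r e' r'] assms(2)
      unfolding field_coplanar_def by (metis Int_absorb)
    with assms(3) show False by simp
  qed
  moreover have "field_sphere e r \<noteq> {}"
  proof
    assume "field_sphere e r = {}"
    moreover have "axis 1 1 \<noteq> (0::'a ^ 3)" by (simp add: axis_eq_0_iff)
    ultimately show False using assms(3) unfolding field_coplanar_def by blast
  qed
  then obtain v where "v \<in> field_sphere e r" by blast
  with assms(2) \<open>e = e'\<close> have "r = r'" by (auto simp: field_sphere_def)
  ultimately show ?thesis by simp
qed

text \<open>The centre is arbitrary and determines the radius.\<close>

lemma card_spheres_through_point: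
  fixes p :: "'a::{field,finite} ^ 3"
  shows "card {s. p \<in> field_sphere (fst s) (snd s)} = CARD('a) ^ 3"
proof -
  let ?g = "\<lambda>e::'a ^ 3. (p $ 1 - e $ 1)\<^sup>2 + (p $ 2 - e $ 2)\<^sup>2 + (p $ 3 - e $ 3)\<^sup>2"
  have "{s. p \<in> field_sphere (fst s) (snd s)} = (\<lambda>e. (e, ?g e)) ` UNIV"
    by (auto simp: field_sphere_def)
  moreover have "inj (\<lambda>e. (e, ?g e))" by (auto intro: injI)
  ultimately show ?thesis by (simp add: card_image)
qed

text \<open>Point and centre play symmetric roles: the centre of a sphere through \<open>p\<close>
  and \<open>p'\<close> lies on two spheres of equal radius about \<open>p\<close> and
  \<open>p'\<close>, hence in their radical plane, the bisector. The centre determines the radius,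
  so counting centres suffices.\<close>

lemma card_spheres_through_two_points_le:
  fixes p p' :: "'a::{field,finite} ^ 3"
  assumes "(2::'a) \<noteq> 0" and "p \<noteq> p'"
  shows "card {s. p \<in> field_sphere (fst s) (snd s) \<and> p' \<in> field_sphere (fst s) (snd s)}
     \<le> CARD('a)\<^sup>2"
proof -
  let ?A = "{s. p \<in> field_sphere (fst s) (snd s) \<and> p' \<in> field_sphere (fst s) (snd s)}"
  let ?n = "2 *s (p' - p)"
  have "?n \<noteq> 0" using assms by (simp add: vector_mul_eq_0)
  have inj: "inj_on fst ?A"
    by (auto simp: inj_on_def field_sphere_def)
  have sym: "x \<in> field_sphere y r \<longleftrightarrow> y \<in> field_sphere x r" for x y :: "'a ^ 3" and r
    by (simp add: field_sphere_def power2_commute)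
  have "fst ` ?A \<subseteq> field_plane ?n (dot3 p' p' - dot3 p p)"
  proof
    fix e assume "e \<in> fst ` ?A"
    then obtain r where "e \<in> field_sphere p r \<inter> field_sphere p' r"
      using sym by fastforce
    then show "e \<in> field_plane ?n (dot3 p' p' - dot3 p p)"
      using field_spheres_inter_subset_plane[of p r p' r] by auto
  qed
  then have "card ?A \<le> card (field_plane ?n (dot3 p' p' - dot3 p p))"
    using inj by (intro card_inj_on_le) auto
  also have "\<dots> \<le> CARD('a)\<^sup>2" by (rule card_field_plane_le) fact
  finally show ?thesis .
qed

section \<open>First and second moments of the incidence counts\<close>

lemma card_inter_eq_sum_of_bool:
  assumes "finite A"
  shows "real (card (A \<inter> B)) = (\<Sum>x\<in>A. of_bool (x \<in> B))"
  using assms by (simp add: Int_def conj_commute)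

context
  fixes P :: "('a::{field,finite} ^ 3) set"
begin

text \<open>Indexing by pairs (centre, radius) makes the sums run over exactly q^4 indices; real
  values allow deviations from the mean of either sign.\<close>

definition incidences :: "('a ^ 3) \<times> 'a \<Rightarrow> real" where
  "incidences s = real (card (P \<inter> field_sphere (fst s) (snd s)))"

lemma incidences_eq_sum:
  "incidences s = (\<Sum>p\<in>P. of_bool (p \<in> field_sphere (fst s) (snd s)))"
  unfolding incidences_def by (rule card_inter_eq_sum_of_bool) simp

lemma sum_incidences: "(\<Sum>s\<in>UNIV. incidences s) = real (card P) * real CARD('a) ^ 3"
proof -
  have "(\<Sum>s\<in>UNIV. incidences s) =
      (\<Sum>p\<in>P. \<Sum>s\<in>UNIV. of_bool (p \<in> field_sphere (fst s) (snd s)))"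
    unfolding incidences_eq_sum by (rule sum.swap)
  also have "\<dots> = (\<Sum>p\<in>P. real (card {s. p \<in> field_sphere (fst s) (snd s)}))"
    by simp
  finally show ?thesis by (simp add: card_spheres_through_point)
qed

text \<open>The square counts ordered pairs of points of \<open>P\<close> on the sphere. After
  exchanging the sums, a diagonal pair contributes q^3 and any other pair at most q^2.\<close>

lemma sum_incidences_squared_le:
  assumes "(2::'a) \<noteq> 0"
  shows "(\<Sum>s\<in>UNIV. (incidences s)\<^sup>2) \<le>
    real (card P) * real CARD('a) ^ 3 + (real (card P))\<^sup>2 * (real CARD('a))\<^sup>2"
proof -
  let ?on = "\<lambda>p s. p \<in> field_sphere (fst s) (snd s)"
  have "(\<Sum>s\<in>UNIV. (incidences s)\<^sup>2) =
      (\<Sum>s\<in>UNIV. \<Sum>p\<in>P. \<Sum>p'\<in>P. of_bool (?on p s \<and> ?on p' s))"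
    unfolding incidences_eq_sum power2_eq_square sum_product of_bool_conj ..
  also have "\<dots> = (\<Sum>p\<in>P. \<Sum>s\<in>UNIV. \<Sum>p'\<in>P. of_bool (?on p s \<and> ?on p' s))"
    by (rule sum.swap)
  also have "\<dots> = (\<Sum>p\<in>P. \<Sum>p'\<in>P. \<Sum>s\<in>UNIV. of_bool (?on p s \<and> ?on p' s))"
    by (intro sum.cong refl sum.swap)
  also have "\<dots> = (\<Sum>p\<in>P. \<Sum>p'\<in>P. real (card {s. ?on p s \<and> ?on p' s}))"
    by simp
  \<comment> \<open>Granting the q^2 to diagonal pairs as well makes the bound split into a diagonal
    sum and a constant sum.\<close>
  also have "\<dots> \<le> (\<Sum>p\<in>P. \<Sum>p'\<in>P. (if p = p' then real CARD('a) ^ 3 else 0) + (real CARD('a))\<^sup>2)"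
  proof (intro sum_mono)
    fix p p' :: "'a ^ 3"
    show "real (card {s. ?on p s \<and> ?on p' s})
      \<le> (if p = p' then real CARD('a) ^ 3 else 0) + (real CARD('a))\<^sup>2"
    proof (cases "p = p'")
      case True
      then show ?thesis by (simp add: card_spheres_through_point)
    next
      case False
      then show ?thesis
        using of_nat_mono[OF card_spheres_through_two_points_le[OF assms False], where 'a=real]
        by simp
    qed
  qed
  also have "\<dots> = real (card P) * real CARD('a) ^ 3 + (real (card P))\<^sup>2 * (real CARD('a))\<^sup>2"
    by (simp add: sum.distrib power2_eq_square algebra_simps)
  finally show ?thesis .
qed

lemma card_poor_spheres_le:
  assumes two: "(2::'a) \<noteq> 0" and P: "card P = 8 * CARD('a)\<^sup>2"
  shows "9 * real (card {s. incidences s \<le> 2 * real CARD('a)}) \<le> 2 * real CARD('a) ^ 3"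
proof -
  let ?q = "real CARD('a)"
  let ?B = "{s. incidences s \<le> 2 * ?q}"
  have q: "?q > 0" by simp
  \<comment> \<open>The mean is 8q^2 * q^3 / q^4 = 8q, so a count of at most 2q deviates by at least
    6q.\<close>
  have "real (card ?B) * (36 * ?q\<^sup>2) = (\<Sum>s\<in>?B. (6 * ?q)\<^sup>2)"
    by (simp add: power_mult_distrib)
  also have "\<dots> \<le> (\<Sum>s\<in>?B. (8 * ?q - incidences s)\<^sup>2)"
    by (intro sum_mono power_mono) auto
  also have "\<dots> \<le> (\<Sum>s\<in>UNIV. (8 * ?q - incidences s)\<^sup>2)"
    by (intro sum_mono2) auto
  also have "\<dots> = (\<Sum>s\<in>UNIV. 64 * ?q\<^sup>2 - 16 * ?q * incidences s + (incidences s)\<^sup>2)"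
    by (intro sum.cong) (auto simp: power2_eq_square algebra_simps)
  also have "\<dots> = 64 * ?q\<^sup>2 * ?q ^ 4 - 16 * ?q * (\<Sum>s\<in>UNIV. incidences s)
      + (\<Sum>s\<in>UNIV. (incidences s)\<^sup>2)"
    by (simp add: sum.distrib sum_subtractf sum_distrib_left eval_nat_numeral)
  \<comment> \<open>The first moment is 8q^5 and the second at most 8q^5 + 64q^6; the terms in q^6
    cancel as 64 - 128 + 64 = 0.\<close>
  also have "\<dots> \<le> 8 * ?q ^ 5"
    using sum_incidences_squared_le[OF two]
    by (simp add: sum_incidences P eval_nat_numeral algebra_simps)
  finally have "?q\<^sup>2 * (4 * (9 * real (card ?B))) \<le> ?q\<^sup>2 * (4 * (2 * ?q ^ 3))"
    by (simp add: eval_nat_numeral algebra_simps)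
  then show ?thesis using q by (simp only: mult_le_cancel_left_pos zero_less_power)
qed

section \<open>Rich spheres are determined, and the final count\<close>

lemma rich_sphere_not_field_coplanar:
  assumes "(2::'a) \<noteq> 0" and "incidences (e, r) > 2 * real CARD('a)"
  shows "\<not> field_coplanar (P \<inter> field_sphere e r)"
proof
  assume "field_coplanar (P \<inter> field_sphere e r)"
  then obtain n d where n: "n \<noteq> 0" and "P \<inter> field_sphere e r \<subseteq> field_plane n d"
    by (auto simp: field_coplanar_def)
  then have "card (P \<inter> field_sphere e r) \<le> card (field_sphere e r \<inter> field_plane n d)"
    by (intro card_mono) auto
  also have "\<dots> \<le> 2 * CARD('a)" by (rule card_plane_section_le) fact+
  finally show False using assms(2) by (simp add: incidences_def)
qed

text \<open>A rich sphere meets \<open>P\<close> in a non-coplanar set. This supplies four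
  determining points and, since the sphere itself is then non-coplanar, makes the passage from pairs
  to point sets injective.\<close>

lemma card_rich_spheres_le_determined:
  assumes two: "(2::'a) \<noteq> 0"
  shows "card {s. incidences s > 2 * real CARD('a)} \<le> card (determined_spheres P)"
proof (rule card_inj_on_le)
  let ?G = "{s. incidences s > 2 * real CARD('a)}"
  let ?S = "\<lambda>s. field_sphere (fst s) (snd s) :: ('a ^ 3) set"
  have nc: "\<not> field_coplanar (P \<inter> ?S s)" if "s \<in> ?G" for s
    using rich_sphere_not_field_coplanar[OF two, of "fst s" "snd s"] that by simp
  show "inj_on ?S ?G"
  proof (rule inj_onI)
    fix s t assume "s \<in> ?G" "?S s = ?S t"
    moreover have "\<not> field_coplanar (?S s)"
      using nc[OF \<open>s \<in> ?G\<close>] unfolding field_coplanar_def by blast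
    ultimately show "s = t" using field_sphere_eq_imp[OF two] by (simp add: prod_eq_iff)
  qed
  show "?S ` ?G \<subseteq> determined_spheres P"
  proof
    fix S assume "S \<in> ?S ` ?G"
    then obtain s where s: "s \<in> ?G" "S = ?S s" by blast
    from not_field_coplanar_imp_four_points[OF nc[OF s(1)]]
    obtain a b c d where "{a, b, c, d} \<subseteq> P \<inter> S" "\<not> field_coplanar {a, b, c, d}"
      using s(2) by metis
    then show "S \<in> determined_spheres P"
      unfolding determined_spheres_def using s(2) by blast
  qed
qed simp

end

theorem theorem1p13:
  fixes P :: "('a::{field,finite} ^ 3) set" and q :: nat
  assumes "primepow q" and "odd q"
    and "CARD('a) = q"
    and "card P = 8 * q ^ 2"
  shows "real (card (determined_spheres P)) \<ge> real q ^ 4 / 9"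
proof -
  have two: "(2::'a) \<noteq> 0"
    using two_neq_zero_if_odd_card assms(2,3) by blast
  let ?B = "{s. incidences P s \<le> 2 * real CARD('a)}"
  let ?G = "{s. incidences P s > 2 * real CARD('a)}"
  have "real q \<ge> 1" using assms(2) by (cases q) auto
  have "card ?B + card ?G = CARD(('a ^ 3) \<times> 'a)"
    by (subst card_Un_disjoint[symmetric])
      (auto intro!: arg_cong[where f = card] simp del: card_prod)
  also have "\<dots> = q ^ 4"
    by (simp add: assms(3) eval_nat_numeral)
  finally have "real q ^ 4 = real (card ?B) + real (card ?G)"
    by (metis of_nat_add of_nat_power)
  moreover have "9 * real (card ?B) \<le> 2 * real q ^ 3"
    using card_poor_spheres_le[OF two] assms(3,4) by simp
  moreover have "real q ^ 3 \<le> real q ^ 4"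
    using \<open>real q \<ge> 1\<close> by (intro power_increasing) auto
  moreover have "real (card ?G) \<le> real (card (determined_spheres P))"
    using card_rich_spheres_le_determined[OF two] by simp
  \<comment> \<open>At least q^4 - 2q^3/9 pairs are rich, and this is at least 7q^4/9.\<close>
  ultimately show ?thesis by linarith
qed

end
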